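(* Let $G$ be a digraph with minimum out-degree $\delta\geq 1200$ and maximum in-degree at most $\frac{\exp(\delta/72)}{12\delta}$. Then $G$ has a majority $3$-colouring. Moreover, the $3$-colouring can be chosen so that, for every vertex $v$ of $G$ and every colour $c\in\{1,2,3\}$, at most half the out-neighbours of $v$ receive colour $c$.
   Context: Digraphs are finite, with no loops and no parallel arcs (a pair of oppositely directed arcs $uv$ and $vu$ is allowed). A majority $3$-colouring of a digraph is a function assigning each vertex one of three colours such that, for each vertex $v$, at most half the out-neighbours of $v$ receive the same colour as $v$. *)

theory Defs
  imports Complex_Main "HOL-Library.FuncSet" "Graph_Theory.Digraph"
begin

definition out_neighbours :: "('a, 'b) pre_digraph \<Rightarrow> 'a \<Rightarrow> 'a set" where
  "out_neighbours G v = {w. v \<rightarrow>\<^bsub>G\<^esub> w}"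

text \<open>On the digraph without vertices, the minimum out-degree and the maximum in-degree
  are unspecified values of type \<^typ>\<open>nat\<close>.\<close>

definition min_out_degree :: "('a, 'b) pre_digraph \<Rightarrow> nat" where
  "min_out_degree G = Min (out_degree G ` verts G)"

definition max_in_degree :: "('a, 'b) pre_digraph \<Rightarrow> nat" where
  "max_in_degree G = Max (in_degree G ` verts G)"

definition majority_3_colouring :: "('a, 'b) pre_digraph \<Rightarrow> ('a \<Rightarrow> nat) \<Rightarrow> bool" where
  "majority_3_colouring G f \<longleftrightarrow>
     f \<in> verts G \<rightarrow> {1, 2, 3} \<and>
     (\<forall>v \<in> verts G.
        real (card {w \<in> out_neighbours G v. f w = f v}) \<le> real (card (out_neighbours G v)) / 2)"

end

theory Submission
  imports Defs "HOL-Probability.Probability"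
begin

text \<open>
  Colour the vertices independently and uniformly with three colours. A vertex \<open>v\<close> of out-degree
  \<open>d\<close> is bad if some colour occurs on more than half of its out-neighbours. If \<open>X\<close> counts the
  out-neighbours of a given colour, then \<open>E (2 ^ X) = (4/3) ^ d\<close>, so Markov's inequality bounds
  the probability of \<open>X > d/2\<close> by \<open>(8/9) powr (d/2) \<le> exp (-d/18)\<close>. Badness of \<open>v\<close> depends
  only on the out-neighbours of \<open>v\<close>, which it shares with at most \<open>d * \<Delta>\<close> vertices, where \<open>\<Delta>\<close> is
  the maximum in-degree. Out-degrees are not bounded above, so the symmetric local lemma does not
  apply; the asymmetric one does, even with the same weight \<open>x = exp (-\<delta>/36)\<close> for all vertices,
  because \<open>3 * exp (-d/18) \<le> x * (1 - x) ^ (d * \<Delta>)\<close> for every \<open>d \<ge> \<delta>\<close>.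
\<close>

section \<open>The local lemma\<close>

text \<open>By induction on the size of \<open>S\<close>, avoiding \<open>S\<close> leaves
  \<open>A i\<close> at most an \<open>x i\<close> fraction of the remaining probability. Avoiding
  the events one after another then costs a factor \<open>1 - x i\<close> each.\<close>

theorem (in prob_space) lovasz_local_lemma:
  fixes A :: "'i \<Rightarrow> 'a set" and N :: "'i \<Rightarrow> 'i set" and x :: "'i \<Rightarrow> real"
  defines "avoid \<equiv> \<lambda>S. space M - (\<Union>i\<in>S. A i)"
  assumes fin: "finite I"
    and events: "\<And>i. i \<in> I \<Longrightarrow> A i \<in> events"
    and x: "\<And>i. i \<in> I \<Longrightarrow> 0 \<le> x i \<and> x i < 1"
    and indep: "\<And>i S. i \<in> I \<Longrightarrow> S \<subseteq> I - insert i (N i) \<Longrightarrow>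
                  prob (A i \<inter> avoid S) = prob (A i) * prob (avoid S)"
    and bound: "\<And>i. i \<in> I \<Longrightarrow> prob (A i) \<le> x i * (\<Prod>j\<in>I \<inter> N i. 1 - x j)"
  shows "(\<Prod>i\<in>I. 1 - x i) \<le> prob (avoid I)"
proof -
  have avoid_event: "avoid S \<in> events" if "S \<subseteq> I" for S
    unfolding avoid_def using events fin that
    by (intro sets.Diff sets.top sets.finite_UN) (auto intro: finite_subset)

  \<comment> \<open>Working with \<open>prob (A i \<inter> avoid S) \<le> x i * prob (avoid S)\<close> instead of conditional
    probabilities avoids dividing by \<open>prob (avoid S)\<close>, not yet known to be positive.\<close>
  have peel: "(\<Prod>i\<in>U. 1 - x i) * prob (avoid T) \<le> prob (avoid (U \<union> T))"
    if "finite U" "U \<inter> T = {}" "U \<union> T \<subseteq> I"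
      and "\<And>i S. i \<in> U \<Longrightarrow> S \<subseteq> U \<union> T - {i} \<Longrightarrow> prob (A i \<inter> avoid S) \<le> x i * prob (avoid S)"
    for U T
    using that
  proof (induction U rule: finite_induct)
    case (insert u U)
    have IH: "(\<Prod>i\<in>U. 1 - x i) * prob (avoid T) \<le> prob (avoid (U \<union> T))"
      using insert.prems by (intro insert.IH) (auto intro!: insert.prems(3))
    have eq: "avoid (insert u U \<union> T) = avoid (U \<union> T) - (A u \<inter> avoid (U \<union> T))"
      by (auto simp: avoid_def)
    have "prob (avoid (insert u U \<union> T)) = prob (avoid (U \<union> T)) - prob (A u \<inter> avoid (U \<union> T))"
      unfolding eq using insert.prems events avoid_event by (intro finite_measure_Diff) auto
    also have "\<dots> \<ge> (1 - x u) * prob (avoid (U \<union> T))"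
      using insert.prems(3)[of u "U \<union> T"] insert.hyps insert.prems(1)
      by (auto simp: algebra_simps)
    finally have "(1 - x u) * prob (avoid (U \<union> T)) \<le> prob (avoid (insert u U \<union> T))" .
    moreover have "(1 - x u) * ((\<Prod>i\<in>U. 1 - x i) * prob (avoid T))
                     \<le> (1 - x u) * prob (avoid (U \<union> T))"
      using x[of u] insert.prems(2) by (intro mult_left_mono IH) auto
    ultimately show ?case
      using insert.hyps by (simp add: mult.assoc)
  qed simp

  have cond: "prob (A i \<inter> avoid S) \<le> x i * prob (avoid S)" if "i \<in> I" "S \<subseteq> I - {i}" for i S
    using that
  proof (induction "card S" arbitrary: S i rule: less_induct)
    case less
    \<comment> \<open>Only \<open>U\<close> can depend on \<open>A i\<close>. Dropping
      \<open>U\<close> makes independence available for \<open>T\<close>; \<open>peel\<close> then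
      returns from \<open>avoid T\<close> to \<open>avoid S\<close>, and the factor it costs is the
      product over \<open>U\<close> contained in \<open>bound\<close>.\<close>
    define U where "U = S \<inter> N i"
    define T where "T = S - N i"
    have S: "S = U \<union> T" and disj: "U \<inter> T = {}"
      by (auto simp: U_def T_def)
    have finS: "finite S"
      using less.prems fin finite_subset by blast
    have "prob (A i \<inter> avoid S) \<le> prob (A i \<inter> avoid T)"
      using less.prems events avoid_event
      by (intro finite_measure_mono sets.Int avoid_event events) (auto simp: avoid_def T_def)
    also have "\<dots> = prob (A i) * prob (avoid T)"
      using less.prems by (intro indep) (auto simp: T_def)
    also have "\<dots> \<le> x i * (\<Prod>j\<in>I \<inter> N i. 1 - x j) * prob (avoid T)"
      using less.prems by (intro mult_right_mono bound) auto
    also have "\<dots> \<le> x i * (\<Prod>j\<in>U. 1 - x j) * prob (avoid T)"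
    proof (intro mult_right_mono mult_left_mono)
      have "(\<Prod>j\<in>I \<inter> N i. 1 - x j) = (\<Prod>j\<in>I \<inter> N i - U. 1 - x j) * (\<Prod>j\<in>U. 1 - x j)"
        using fin less.prems by (intro prod.subset_diff) (auto simp: U_def)
      also have "\<dots> \<le> (\<Prod>j\<in>U. 1 - x j)"
        using x less.prems
        by (intro mult_left_le_one_le prod_nonneg prod_le_1) (auto simp: U_def less_imp_le)
      finally show "(\<Prod>j\<in>I \<inter> N i. 1 - x j) \<le> (\<Prod>j\<in>U. 1 - x j)" .
    qed (use x less.prems in auto)
    also have "\<dots> = x i * ((\<Prod>j\<in>U. 1 - x j) * prob (avoid T))"
      by simp
    also have "\<dots> \<le> x i * prob (avoid (U \<union> T))"
    proof (intro mult_left_mono peel)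
      fix j R assume "j \<in> U" "R \<subseteq> U \<union> T - {j}"
      moreover from this have "card R < card S"
        using finS by (intro psubset_card_mono) (auto simp: S)
      ultimately show "prob (A j \<inter> avoid R) \<le> x j * prob (avoid R)"
        using less.prems by (intro less.hyps) (auto simp: S)
    qed (use x less.prems finS disj S in auto)
    finally show ?case
      by (simp add: S)
  qed

  have "(\<Prod>i\<in>I. 1 - x i) * prob (avoid {}) \<le> prob (avoid (I \<union> {}))"
    using fin by (intro peel cond) auto
  then show ?thesis
    by (simp add: avoid_def prob_space)
qed

section \<open>Independent choices\<close>

text \<open>Supports are countable, so cutting both factors down to them reduces arbitrary sets to
  the product rule for countable ones.\<close>

lemma measure_pair_pmf_Times:
  "measure_pmf.prob (pair_pmf p q) (X \<times> Y) = measure_pmf.prob p X * measure_pmf.prob q Y"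
proof -
  have "measure_pmf.prob (pair_pmf p q) (X \<times> Y)
          = measure_pmf.prob (pair_pmf p q) ((X \<times> Y) \<inter> set_pmf (pair_pmf p q))"
    by (rule measure_Int_set_pmf [symmetric])
  also have "(X \<times> Y) \<inter> set_pmf (pair_pmf p q) = (X \<inter> set_pmf p) \<times> (Y \<inter> set_pmf q)"
    by auto
  also have "measure_pmf.prob (pair_pmf p q) \<dots>
               = measure_pmf.prob p (X \<inter> set_pmf p) * measure_pmf.prob q (Y \<inter> set_pmf q)"
    by (intro measure_pmf_prob_product) auto
  finally show ?thesis
    by (simp add: measure_Int_set_pmf)
qed

text \<open>The product measure on \<open>V\<close> is the image of independent choices on
  \<open>V \<inter> W\<close> and \<open>V - W\<close>; \<open>P\<close> sees only the first and
  \<open>Q\<close> only the second, so the joint event is a rectangle.\<close>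

lemma Pi_pmf_indep_disjoint_coords:
  assumes "finite V"
    and P: "\<And>f g. (\<And>v. v \<in> W \<Longrightarrow> f v = g v) \<Longrightarrow> P f = P g"
    and Q: "\<And>f g. (\<And>v. v \<notin> W \<Longrightarrow> f v = g v) \<Longrightarrow> Q f = Q g"
  shows "measure_pmf.prob (Pi_pmf V d p) {f. P f \<and> Q f} =
           measure_pmf.prob (Pi_pmf V d p) {f. P f} * measure_pmf.prob (Pi_pmf V d p) {f. Q f}"
proof -
  define pV where "pV = Pi_pmf V d p"
  define q where "q = pair_pmf (Pi_pmf (V \<inter> W) d p) (Pi_pmf (V - W) d p)"
  define h where "h = (\<lambda>(f, g) v. if v \<in> V \<inter> W then f v else g v :: 'b)"
  have "Pi_pmf (V \<inter> W \<union> (V - W)) d p = map_pmf h q"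
    unfolding h_def q_def using assms(1) by (intro Pi_pmf_union) auto
  moreover have "V \<inter> W \<union> (V - W) = V"
    by auto
  ultimately have pV: "pV = map_pmf h q"
    by (simp add: pV_def)
  \<comment> \<open>On \<open>W - V\<close> the glued function takes its value from
    \<open>g\<close>; it still agrees with \<open>f\<close> there because both equal the default
    \<open>d\<close>.\<close>
  have supp: "f v = d" "g v = d" if "(f, g) \<in> set_pmf q" "v \<notin> V" for f g v
    using that assms(1) set_Pi_pmf_subset[of "V \<inter> W" d p] set_Pi_pmf_subset[of "V - W" d p]
    by (auto simp: q_def)
  have Ph: "P (h (f, g)) = P f" and Qh: "Q (h (f, g)) = Q g" if "(f, g) \<in> set_pmf q" for f g
    using supp[OF that] by (auto simp: h_def intro!: P Q)
  have prob_pV: "measure_pmf.prob pV {f. R f} = measure_pmf.prob q (X \<times> Y)"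
    if "\<And>f g. (f, g) \<in> set_pmf q \<Longrightarrow> R (h (f, g)) \<longleftrightarrow> f \<in> X \<and> g \<in> Y" for R X Y
    unfolding pV using that
    by (auto simp: vimage_def intro!: measure_pmf.finite_measure_eq_AE AE_pmfI)
  have "measure_pmf.prob pV {f. P f \<and> Q f} = measure_pmf.prob q ({f. P f} \<times> {g. Q g})"
       "measure_pmf.prob pV {f. P f} = measure_pmf.prob q ({f. P f} \<times> UNIV)"
       "measure_pmf.prob pV {f. Q f} = measure_pmf.prob q (UNIV \<times> {g. Q g})"
    by (intro prob_pV; auto simp: Ph Qh)+
  then show ?thesis
    by (simp add: q_def measure_pair_pmf_Times flip: pV_def)
qed

lemma prob_colour_majority_le:
  fixes V :: "'a set"
  assumes V: "finite V" and W: "W \<subseteq> V" and c: "c \<in> {1, 2, 3}"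
  shows "measure_pmf.prob (Pi_pmf V d (\<lambda>_. pmf_of_set {1, 2, 3 :: nat}))
           {f. card W < 2 * card {w \<in> W. f w = c}} \<le> exp (- real (card W) / 18)"
proof -
  define p where "p = Pi_pmf V d (\<lambda>_. pmf_of_set {1, 2, 3 :: nat})"
  \<comment> \<open>The product of these factors is \<open>2 ^ X\<close>, with \<open>X\<close> the
    number of vertices of \<open>W\<close> coloured \<open>c\<close>. The base 2 is optimal: it
    minimises \<open>(2 + t) / (3 * sqrt t)\<close> over \<open>t > 0\<close>.\<close>
  define h :: "'a \<Rightarrow> nat \<Rightarrow> real" where "h = (\<lambda>v k. if v \<in> W \<and> k = c then 2 else 1)"
  let ?n = "card W"
  have prod_h: "(\<Prod>v\<in>V. h v (f v)) = 2 ^ card {w \<in> W. f w = c}" for f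
  proof -
    have "{v \<in> V. v \<in> W \<and> f v = c} = {w \<in> W. f w = c}"
      using W by auto
    then show ?thesis
      using V by (simp add: h_def prod.If_cases Int_def)
  qed
  have exp_h: "measure_pmf.expectation (pmf_of_set {1, 2, 3}) (h v) = (if v \<in> W then 4 / 3 else 1)"
    for v
    using c by (auto simp: integral_pmf_of_set h_def)
  have "finite (set_pmf p)"
    unfolding p_def using V by (subst set_Pi_pmf) auto
  then have int: "integrable p (\<lambda>f. \<Prod>v\<in>V. h v (f v))"
    by (rule integrable_measure_pmf_finite)
  have "measure_pmf.expectation p (\<lambda>f. \<Prod>v\<in>V. h v (f v)) = (\<Prod>v\<in>V. if v \<in> W then 4 / 3 else 1)"
    unfolding p_def exp_h [symmetric] using V
    by (intro expectation_prod_Pi_pmf integrable_measure_pmf_finite) (auto simp: h_def)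
  also have "\<dots> = (4 / 3) ^ ?n"
    using V W by (simp add: prod.If_cases Int_absorb1)
  finally have expectation: "measure_pmf.expectation p (\<lambda>f. \<Prod>v\<in>V. h v (f v)) = (4 / 3) ^ ?n" .

  have "measure_pmf.prob p {f. ?n < 2 * card {w \<in> W. f w = c}}
          \<le> measure_pmf.prob p {f \<in> space p. sqrt 2 ^ ?n \<le> (\<Prod>v\<in>V. h v (f v))}"
  proof (intro measure_pmf.finite_measure_mono subsetI)
    fix f assume "f \<in> {f. ?n < 2 * card {w \<in> W. f w = c}}"
    then have "sqrt 2 ^ ?n \<le> sqrt 2 ^ (2 * card {w \<in> W. f w = c})"
      by (intro power_increasing) auto
    then show "f \<in> {f \<in> space p. sqrt 2 ^ ?n \<le> (\<Prod>v\<in>V. h v (f v))}"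
      by (simp add: prod_h power_mult)
  qed simp
  also have "\<dots> \<le> (4 / 3) ^ ?n / sqrt 2 ^ ?n"
    unfolding expectation [symmetric] using int
    by (intro integral_Markov_inequality_measure[where A = "space p"] AE_pmfI) (auto simp: prod_h)
  also have "\<dots> = (4 / 3 / sqrt 2) ^ ?n"
    by (simp add: power_divide)
  also have "\<dots> \<le> exp (- 1 / 18) ^ ?n"
  proof (intro power_mono)
    \<comment> \<open>Squaring removes the root: the square is 8/9, at most
      \<open>exp (- 1 / 9)\<close>.\<close>
    have "(4 / 3 / sqrt 2)\<^sup>2 = 1 + (- 1 / 9 :: real)"
      by (simp add: power_divide)
    also have "\<dots> \<le> exp (- 1 / 9)"
      by (rule exp_ge_add_one_self)
    also have "\<dots> = exp (- 1 / 18) ^ 2"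
      by (simp flip: exp_of_nat_mult)
    finally show "4 / 3 / sqrt 2 \<le> exp (- 1 / 18 :: real)"
      by (rule power2_le_imp_le) simp
  qed simp
  also have "\<dots> = exp (- real ?n / 18)"
    by (simp flip: exp_of_nat_mult)
  finally show ?thesis
    by (simp add: p_def)
qed

section \<open>Degrees\<close>

context digraph
begin

lemma finite_out_neighbours: "finite (out_neighbours G v)"
  by (rule finite_subset[OF _ finite_verts]) (auto simp: out_neighbours_def adj_in_verts)

text \<open>Without parallel arcs, distinct arcs leaving \<open>v\<close> have distinct
  heads.\<close>

lemma card_out_neighbours: "card (out_neighbours G v) = out_degree G v"
proof -
  have "out_neighbours G v = head G ` out_arcs G v"
    by (auto simp: out_neighbours_def arcs_ends_conv out_arcs_def image_iff)
  moreover have "inj_on (head G) (out_arcs G v)"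
    by (auto simp: inj_on_def out_arcs_def arc_to_ends_def intro: no_multi_arcs)
  ultimately show ?thesis
    by (simp add: card_image out_degree_def)
qed

lemma min_out_degree_le: "v \<in> verts G \<Longrightarrow> min_out_degree G \<le> card (out_neighbours G v)"
  by (simp add: card_out_neighbours min_out_degree_def)

lemma card_in_neighbours_le:
  assumes "w \<in> verts G"
  shows "card {u. w \<in> out_neighbours G u} \<le> max_in_degree G"
proof -
  have "{u. w \<in> out_neighbours G u} = tail G ` in_arcs G w"
    by (auto simp: out_neighbours_def arcs_ends_conv in_arcs_def image_iff)
  then have "card {u. w \<in> out_neighbours G u} \<le> in_degree G w"
    by (simp add: in_degree_def card_image_le finite_in_arcs)
  also have "\<dots> \<le> max_in_degree G"
    using assms by (simp add: max_in_degree_def)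
  finally show ?thesis .
qed

text \<open>Bounds the dependencies of a bad event: choose the common out-neighbour, then one of its
  in-neighbours.\<close>

lemma card_common_out_neighbour_le:
  "card {u. out_neighbours G u \<inter> out_neighbours G v \<noteq> {}}
     \<le> card (out_neighbours G v) * max_in_degree G"
proof -
  have "{u. out_neighbours G u \<inter> out_neighbours G v \<noteq> {}}
          = (\<Union>w\<in>out_neighbours G v. {u. w \<in> out_neighbours G u})"
    by auto
  also have "card \<dots> \<le> (\<Sum>w\<in>out_neighbours G v. card {u. w \<in> out_neighbours G u})"
    by (intro card_UN_le finite_out_neighbours)
  also have "\<dots> \<le> (\<Sum>w\<in>out_neighbours G v. max_in_degree G)"
    by (intro sum_mono card_in_neighbours_le) (auto simp: out_neighbours_def adj_in_verts)
  finally show ?thesis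
    by simp
qed

end

section \<open>Majority colourings\<close>

text \<open>Both the exponent \<open>d / 18\<close> and the bound on \<open>n\<close> grow linearly
  in \<open>d\<close>, so one weight serves all out-degrees. Half of \<open>d / 18\<close> pays for
  \<open>x\<close>; the other half pays for the factor 3 and the power of
  \<open>1 - x\<close>.\<close>

lemma local_lemma_weight_bound:
  fixes d \<delta> \<Delta> :: real
  assumes "1200 \<le> \<delta>" "\<delta> \<le> d" "0 \<le> \<Delta>" "\<Delta> \<le> exp (\<delta> / 72) / (12 * \<delta>)" "real n \<le> d * \<Delta>"
  defines "x \<equiv> exp (- \<delta> / 36)"
  shows "3 * exp (- d / 18) \<le> x * (1 - x) ^ n"
proof -
  have x: "0 < x" "x \<le> 1 / 2"
  proof -
    have "x \<le> exp (- 1)"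
      using assms by (simp add: x_def)
    also have "\<dots> \<le> 1 / 2"
      using exp_ge_add_one_self[of 1] by (simp add: exp_minus field_simps)
    finally show "x \<le> 1 / 2" .
  qed (simp add: x_def)
  \<comment> \<open>Rests on \<open>(1 - x) * (1 + 2 * x) \<ge> 1\<close>, valid for
    \<open>0 \<le> x \<le> 1 / 2\<close>.\<close>
  have lower: "exp (- (2 * x)) \<le> 1 - x"
  proof -
    have "1 / (1 - x) \<le> 1 + 2 * x"
      using x by (simp add: field_simps)
    also have "\<dots> \<le> exp (2 * x)"
      by (rule exp_ge_add_one_self)
    finally show ?thesis
      using x by (simp add: exp_minus field_simps)
  qed
  have "real n * (2 * x) \<le> d * \<Delta> * (2 * x)"
    using assms(5) x by (intro mult_right_mono) auto
  also have "\<dots> \<le> d * (exp (\<delta> / 72) / (12 * \<delta>)) * (2 * x)"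
    using assms x by (intro mult_right_mono mult_left_mono) auto
  \<comment> \<open>The weight \<open>x\<close> outweighs the exponential in-degree bound, leaving
    \<open>exp (- \<delta> / 72)\<close>. Below, 7200 is 6 times 1200.\<close>
  also have "\<dots> = d / (6 * \<delta>) * exp (- \<delta> / 72)"
    by (simp add: x_def field_simps flip: exp_add)
  also have "\<dots> \<le> d / (6 * \<delta>) * 1"
    using assms by (intro mult_left_mono) auto
  also have "\<dots> \<le> d / 7200"
    using assms by (simp add: field_simps)
  finally have n: "real n * (2 * x) \<le> d / 7200" .

  have "(3 :: real) \<le> 1 + (d / 36 - d / 7200)"
    using assms by simp
  also have "\<dots> \<le> exp (d / 36 - d / 7200)"
    by (rule exp_ge_add_one_self)
  finally have "3 * exp (- d / 18) \<le> exp (d / 36 - d / 7200) * exp (- d / 18)"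
    by simp
  also have "\<dots> = exp (- d / 36 - d / 7200)"
    by (simp flip: exp_add)
  also have "\<dots> \<le> exp (- \<delta> / 36 - real n * (2 * x))"
    using assms n by simp
  also have "\<dots> = x * exp (- (2 * x)) ^ n"
    by (simp add: x_def flip: exp_add exp_of_nat_mult)
  also have "\<dots> \<le> x * (1 - x) ^ n"
    using x lower by (intro mult_left_mono power_mono) auto
  finally show ?thesis .
qed

theorem theorem4:
  fixes G :: "('a, 'b) pre_digraph" and \<delta> :: nat
  assumes "digraph G"
    and "min_out_degree G = \<delta>"
    and "\<delta> \<ge> 1200"
    and "real (max_in_degree G) \<le> exp (real \<delta> / 72) / (12 * real \<delta>)"
  shows "\<exists>f. majority_3_colouring G f \<and>
           (\<forall>v \<in> verts G. \<forall>c \<in> {1, 2, 3}.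
              real (card {w \<in> out_neighbours G v. f w = c}) \<le> real (card (out_neighbours G v)) / 2)"
proof -
  interpret digraph G by fact
  define p where "p = Pi_pmf (verts G) 0 (\<lambda>_. pmf_of_set {1, 2, 3 :: nat})"
  define bad where
    "bad v c = {f. card (out_neighbours G v) < 2 * card {w \<in> out_neighbours G v. f w = c}}"
    for v and c :: nat
  define A where "A v = (\<Union>c\<in>{1, 2, 3}. bad v c)" for v
  \<comment> \<open>A vertex lies in its own \<open>N v\<close>, as its out-degree is positive; the
    count of dependencies includes it.\<close>
  define N where "N v = {u. out_neighbours G u \<inter> out_neighbours G v \<noteq> {}}" for v
  define x where "x = exp (- real \<delta> / 36)"
  have x: "0 \<le> x" "x < 1"
    using assms(3) by (auto simp: x_def)

  have prob_A: "measure_pmf.prob p (A v) \<le> x * (\<Prod>u\<in>verts G \<inter> N v. 1 - x)" if v: "v \<in> verts G" for v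
  proof -
    let ?d = "card (out_neighbours G v)"
    have sub: "out_neighbours G v \<subseteq> verts G"
      by (auto simp: out_neighbours_def adj_in_verts)
    have "measure_pmf.prob p (A v) \<le> (\<Sum>c\<in>{1, 2, 3}. measure_pmf.prob p (bad v c))"
      unfolding A_def by (intro measure_pmf.finite_measure_subadditive_finite) auto
    also have "\<dots> \<le> (\<Sum>c\<in>{1, 2, 3 :: nat}. exp (- real ?d / 18))"
      unfolding p_def bad_def by (intro sum_mono prob_colour_majority_le finite_verts sub)
    also have "\<dots> = 3 * exp (- real ?d / 18)"
      by simp
    also have "\<dots> \<le> x * (1 - x) ^ card (verts G \<inter> N v)"
      unfolding x_def
    proof (rule local_lemma_weight_bound)
      have "card (verts G \<inter> N v) \<le> card (N v)"
      proof (rule card_mono)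
        have "N v \<subseteq> verts G"
          by (auto simp: N_def out_neighbours_def adj_in_verts)
        then show "finite (N v)"
          using finite_verts by (rule finite_subset)
      qed auto
      also have "\<dots> \<le> ?d * max_in_degree G"
        unfolding N_def by (rule card_common_out_neighbour_le)
      finally show "real (card (verts G \<inter> N v)) \<le> real ?d * real (max_in_degree G)"
        by (metis of_nat_le_iff of_nat_mult)
    qed (use assms min_out_degree_le[OF v] in auto)
    finally show ?thesis
      by simp
  qed

  have indep: "measure_pmf.prob p (A v \<inter> (space p - (\<Union>u\<in>S. A u)))
                 = measure_pmf.prob p (A v) * measure_pmf.prob p (space p - (\<Union>u\<in>S. A u))"
    if S: "S \<subseteq> verts G - insert v (N v)" for v S
  proof -
    have local: "f \<in> A u \<longleftrightarrow> g \<in> A u" if "\<And>w. w \<in> out_neighbours G u \<Longrightarrow> f w = g w" for f g u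
    proof -
      have "{w \<in> out_neighbours G u. f w = c} = {w \<in> out_neighbours G u. g w = c}" for c
        using that by auto
      then show ?thesis
        by (simp add: A_def bad_def)
    qed
    have "measure_pmf.prob p {f. f \<in> A v \<and> f \<notin> (\<Union>u\<in>S. A u)}
            = measure_pmf.prob p {f. f \<in> A v} * measure_pmf.prob p {f. f \<notin> (\<Union>u\<in>S. A u)}"
      unfolding p_def
    \<comment> \<open>For \<open>u\<close> in \<open>S\<close>, the out-neighbourhood of
      \<open>u\<close> misses that of \<open>v\<close>, so avoiding \<open>S\<close> is decided by
      coordinates outside \<open>W\<close>.\<close>
    proof (rule Pi_pmf_indep_disjoint_coords[where W = "out_neighbours G v"])
      fix f g :: "'a \<Rightarrow> nat" assume fg: "\<And>w. w \<notin> out_neighbours G v \<Longrightarrow> f w = g w"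
      have "f \<in> A u \<longleftrightarrow> g \<in> A u" if "u \<in> S" for u
        using that S by (intro local fg) (auto simp: N_def)
      then show "(f \<notin> (\<Union>u\<in>S. A u)) = (g \<notin> (\<Union>u\<in>S. A u))"
        by auto
    qed (auto intro!: local)
    then show ?thesis
      by (simp add: Int_def Compl_eq Compl_eq_Diff_UNIV [symmetric])
  qed

  have "0 < (\<Prod>v\<in>verts G. 1 - x)"
    using x by simp
  also have "\<dots> \<le> measure_pmf.prob p (space p - (\<Union>v\<in>verts G. A v))"
    using x prob_A indep
    by (intro measure_pmf.lovasz_local_lemma[where N = N]) auto
  \<comment> \<open>Intersecting with the support ensures that the colouring found uses only colours
    1, 2, 3 on the vertices.\<close>
  finally have "measure_pmf.prob p ((space p - (\<Union>v\<in>verts G. A v)) \<inter> set_pmf p) \<noteq> 0"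
    by (simp add: measure_Int_set_pmf)
  then have "(space p - (\<Union>v\<in>verts G. A v)) \<inter> set_pmf p \<noteq> {}"
    by (metis measure_empty)
  then obtain f where f: "f \<in> set_pmf p" "\<And>v. v \<in> verts G \<Longrightarrow> f \<notin> A v"
    by auto
  have colours: "f v \<in> {1, 2, 3}" if "v \<in> verts G" for v
    using f(1) that by (auto simp: p_def set_Pi_pmf PiE_dflt_def)
  \<comment> \<open>This is the stronger claim for every colour; the majority condition is the case
    \<open>c = f v\<close>.\<close>
  have "real (card {w \<in> out_neighbours G v. f w = c}) \<le> real (card (out_neighbours G v)) / 2"
    if "v \<in> verts G" "c \<in> {1, 2, 3}" for v c
    using f(2)[OF that(1)] that(2) by (fastforce simp: A_def bad_def not_less)
  with colours show ?thesis
    by (auto simp: majority_3_colouring_def intro!: exI[of _ f])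
qed

end
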